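(* Let $K$ be the Kronecker quiver, let $\mathcal B(K)$ be the canonical basis of $\mathcal A(K)$ and $\mathcal B'(K)$ its semicanonical basis. There is a positive locally unipotent base change from $\mathcal B(K)$ to $\mathcal B'(K)$.
   Context: $K$ is the Kronecker quiver (two vertices $1,2$ and two arrows $2\to1$), and $\mathcal A(K)$ is the coefficient-free cluster algebra with initial seed $(K,(u_1,u_2))$. A cluster monomial is a monomial in cluster variables of one same cluster. Let $z=\dfrac{1+u_1^2+u_2^2}{u_1u_2}\in\mathcal A(K)$. Normalized Chebyshev polynomials of the second kind: $C_{-2}=C_{-1}=0$, $C_0=1$, $C_{n+1}(x)=xC_n(x)-C_{n-1}(x)$ for $n\ge0$. Normalized Chebyshev polynomials of the first kind: $P_n(x)=C_n(x)-C_{n-2}(x)$ for $n\ge0$ (so $P_0=1$, $P_1=x$, and $P_n(t+t^{-1})=t^n+t^{-n}$ for $n\geq1$). The canonical basis (Sherman-Zelevinsky) is the $\mathbb Z$-basis $\mathcal B(K)=\{\text{cluster monomials}\}\sqcup\{P_n(z):n\ge1\}$ of $\mathcal A(K)$. The semicanonical basis is $\mathcal B'(K)=\{X_{\mathbf d}:\mathbf d\in\mathbb Z^{2}\}=\{\text{cluster monomials}\}\sqcup\{z^n:n\ge1\}$, the set of generic variables, where $X_{\mathbf d}$ is the generic value of the Caldero-Chapoton map on representations of $K$ of dimension $\mathbf d$ for $\mathbf d\in\mathbb N^2$ and $X_{\mathbf d}=X_{[\mathbf d]_+}\prod_{d_i<0}u_i^{-d_i}$ with $[\mathbf d]_+=(\max(d_i,0))_i$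 in general. For two enumerated bases $\mathfrak a=\{a_n,n\ge0\}$ and $\mathfrak b=\{b_n,n\ge0\}$ of the $\mathbb Z$-module $\mathcal A(K)$, there is a locally unipotent base change from $\mathfrak a$ to $\mathfrak b$ if for every $n\geq 0$ the $\mathbb Z$-modules spanned by $\{a_k,0\le k\le n\}$ and $\{b_k,0\le k\le n\}$ coincide and the base change matrix from $(a_k)_{0\le k\le n}$ to $(b_k)_{0\le k\le n}$ (whose $k$-th column is formed by the coordinates of $b_k$ in $(a_0,\dots,a_n)$) is a unipotent integer matrix. It is positive if moreover these matrices have non-negative entries. For bases given as sets, this means for suitable enumerations of the two sets. *)

theory Defs
  imports
    "HOL-Computational_Algebra.Computational_Algebra"
    "Jordan_Normal_Form.Matrix"
begin

section \<open>Coefficient-free cluster algebras of quivers\<close>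

text \<open>A quiver is given by its numbers of arrows: \<open>Q i j\<close> is the number of arrows \<open>i \<rightarrow> j\<close>.
  A quiver without loops and 2-cycles is recorded by its skew-symmetric exchange matrix.\<close>

definition exchange_matrix :: "('v \<Rightarrow> 'v \<Rightarrow> nat) \<Rightarrow> 'v \<Rightarrow> 'v \<Rightarrow> int" where
  "exchange_matrix Q i j = int (Q i j) - int (Q j i)"

type_synonym ('v, 'f) seed = "('v \<Rightarrow> 'v \<Rightarrow> int) \<times> ('v \<Rightarrow> 'f)"

definition mutate_matrix :: "'v \<Rightarrow> ('v \<Rightarrow> 'v \<Rightarrow> int) \<Rightarrow> 'v \<Rightarrow> 'v \<Rightarrow> int" where
  "mutate_matrix k b i j =
     (if i = k \<or> j = k then - b i j
      else b i j + max (b i k) 0 * max (b k j) 0 - max (- b i k) 0 * max (- b k j) 0)"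

text \<open>In the exchange relation the exponents \<open>nat (b i k)\<close> and \<open>nat (- b i k)\<close> are the positive
  parts of \<open>b i k\<close> and \<open>- b i k\<close>, since \<open>nat\<close> sends negative integers to 0.\<close>

definition mutate_cluster ::
  "'v::finite \<Rightarrow> ('v \<Rightarrow> 'v \<Rightarrow> int) \<Rightarrow> ('v \<Rightarrow> 'f::field) \<Rightarrow> 'v \<Rightarrow> 'f" where
  "mutate_cluster k b x =
     x(k := ((\<Prod>i\<in>UNIV. x i ^ nat (b i k)) + (\<Prod>i\<in>UNIV. x i ^ nat (- b i k))) / x k)"

definition mutate :: "'v::finite \<Rightarrow> ('v, 'f::field) seed \<Rightarrow> ('v, 'f) seed" where
  "mutate k s = (mutate_matrix k (fst s), mutate_cluster k (fst s) (snd s))"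

inductive_set seeds :: "('v::finite, 'f::field) seed \<Rightarrow> ('v, 'f) seed set"
  for s0 :: "('v, 'f) seed" where
  initial: "s0 \<in> seeds s0"
| mutation: "s \<in> seeds s0 \<Longrightarrow> mutate k s \<in> seeds s0"

definition cluster_variables :: "('v::finite, 'f::field) seed \<Rightarrow> 'f set" where
  "cluster_variables s0 = (\<Union>s\<in>seeds s0. range (snd s))"

definition cluster_monomials :: "('v::finite, 'f::field) seed \<Rightarrow> 'f set" where
  "cluster_monomials s0 = {(\<Prod>i\<in>UNIV. snd s i ^ m i) | s m. s \<in> seeds s0}"

text \<open>The cluster algebra is the subring (i.e. \<open>\<int>\<close>-subalgebra) of the ambient field generated by
  the cluster variables.\<close>

inductive_set cluster_algebra :: "('v::finite, 'f::field) seed \<Rightarrow> 'f set"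
  for s0 :: "('v, 'f) seed" where
  variable: "x \<in> cluster_variables s0 \<Longrightarrow> x \<in> cluster_algebra s0"
| one: "1 \<in> cluster_algebra s0"
| diff: "x \<in> cluster_algebra s0 \<Longrightarrow> y \<in> cluster_algebra s0 \<Longrightarrow> x - y \<in> cluster_algebra s0"
| mult: "x \<in> cluster_algebra s0 \<Longrightarrow> y \<in> cluster_algebra s0 \<Longrightarrow> x * y \<in> cluster_algebra s0"


section \<open>The Kronecker quiver\<close>

datatype kvertex = V1 | V2

instance kvertex :: finite
proof
  have "(UNIV :: kvertex set) = {V1, V2}"
    using kvertex.exhaust by auto
  then show "finite (UNIV :: kvertex set)"
    by (metis finite.emptyI finite.insertI)
qed

definition kronecker_quiver :: "kvertex \<Rightarrow> kvertex \<Rightarrow> nat" where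
  "kronecker_quiver i j = (if i = V2 \<and> j = V1 then 2 else 0)"

text \<open>The ambient field is \<open>\<rat>(u\<^sub>1, u\<^sub>2)\<close>, realised as the fraction field of \<open>\<rat>[u\<^sub>1][u\<^sub>2]\<close>.\<close>

type_synonym ambient = "rat poly poly fract"

definition u1 :: ambient where
  "u1 = Fract [:[:0, 1:]:] 1"

definition u2 :: ambient where
  "u2 = Fract [:0, 1:] 1"

definition initial_seed :: "(kvertex, ambient) seed" where
  "initial_seed = (exchange_matrix kronecker_quiver, case_kvertex u1 u2)"

definition z :: ambient where
  "z = (1 + u1 ^ 2 + u2 ^ 2) / (u1 * u2)"


section \<open>Normalized Chebyshev polynomials\<close>

text \<open>As polynomial functions. The second kind is indexed by integers and vanishes at all negative
  indices; only the indices -2 and -1 are ever used.\<close>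

function chebyshev_C :: "int \<Rightarrow> 'a::comm_ring_1 \<Rightarrow> 'a" where
  "chebyshev_C n x =
     (if n < 0 then 0
      else if n = 0 then 1
      else x * chebyshev_C (n - 1) x - chebyshev_C (n - 2) x)"
  by pat_completeness auto
termination
  by (relation "measure (\<lambda>(n, x). nat (n + 1))") auto

declare chebyshev_C.simps [simp del]

definition chebyshev_P :: "nat \<Rightarrow> 'a::comm_ring_1 \<Rightarrow> 'a" where
  "chebyshev_P n x = chebyshev_C (int n) x - chebyshev_C (int n - 2) x"


section \<open>Canonical and semicanonical basis\<close>

definition canonical_basis :: "ambient set" where
  "canonical_basis = cluster_monomials initial_seed \<union> {chebyshev_P n z | n. n \<ge> 1}"

text \<open>The set of generic variables of the Kronecker quiver, in its explicit description: the generic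
  values of the Caldero-Chapoton map are the cluster monomials together with the powers of \<open>z\<close>
  (the value \<open>z ^ n\<close> being taken at the dimension vector \<open>(n, n)\<close>).\<close>

definition semicanonical_basis :: "ambient set" where
  "semicanonical_basis = cluster_monomials initial_seed \<union> {z ^ n | n. n \<ge> 1}"


section \<open>Locally unipotent base changes\<close>

definition zscale :: "int \<Rightarrow> 'a::comm_ring_1 \<Rightarrow> 'a" where
  "zscale k x = of_int k * x"

interpretation zmod: Modules.module "zscale :: int \<Rightarrow> 'a::comm_ring_1 \<Rightarrow> 'a"
  by unfold_locales (simp_all add: zscale_def algebra_simps)

definition enumerated_basis :: "'a::comm_ring_1 set \<Rightarrow> (nat \<Rightarrow> 'a) \<Rightarrow> bool" where
  "enumerated_basis A a \<longleftrightarrow>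
     inj a \<and> \<not> zmod.dependent (range a) \<and> zmod.span (range a) = A"

definition base_change_matrix ::
  "(nat \<Rightarrow> 'a::comm_ring_1) \<Rightarrow> (nat \<Rightarrow> 'a) \<Rightarrow> nat \<Rightarrow> int mat \<Rightarrow> bool" where
  "base_change_matrix a b n M \<longleftrightarrow>
     M \<in> carrier_mat (Suc n) (Suc n) \<and>
     (\<forall>k\<le>n. b k = (\<Sum>i\<le>n. zscale (M $$ (i, k)) (a i)))"

definition unipotent_mat :: "int mat \<Rightarrow> bool" where
  "unipotent_mat M \<longleftrightarrow>
     (\<exists>r. (M - 1\<^sub>m (dim_row M)) ^\<^sub>m r = 0\<^sub>m (dim_row M) (dim_row M))"

definition nonneg_mat :: "int mat \<Rightarrow> bool" where
  "nonneg_mat M \<longleftrightarrow> (\<forall>i<dim_row M. \<forall>j<dim_col M. 0 \<le> M $$ (i, j))"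

text \<open>The matrix below is unique, because the \<open>a k\<close> are linearly independent.\<close>

definition pos_loc_unipotent_base_change ::
  "'a::comm_ring_1 set \<Rightarrow> (nat \<Rightarrow> 'a) \<Rightarrow> (nat \<Rightarrow> 'a) \<Rightarrow> bool" where
  "pos_loc_unipotent_base_change A a b \<longleftrightarrow>
     enumerated_basis A a \<and> enumerated_basis A b \<and>
     (\<forall>n. zmod.span (a ` {..n}) = zmod.span (b ` {..n}) \<and>
          (\<exists>M. base_change_matrix a b n M \<and> unipotent_mat M \<and> nonneg_mat M))"

definition pos_loc_unipotent_base_change_sets ::
  "'a::comm_ring_1 set \<Rightarrow> 'a set \<Rightarrow> 'a set \<Rightarrow> bool" where
  "pos_loc_unipotent_base_change_sets A S T \<longleftrightarrow>
     (\<exists>a b. range a = S \<and> range b = T \<and> pos_loc_unipotent_base_change A a b)"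

end

theory Submission
  imports Defs "HOL-Library.Countable_Set" "HOL-Library.Product_Lexorder"
begin

text \<open>The cluster variables \<open>x\<^sub>n\<close>, \<open>n \<in> \<int>\<close>, satisfy \<open>x\<^sub>n\<^sub>+\<^sub>1 = z x\<^sub>n - x\<^sub>n\<^sub>-\<^sub>1\<close>,
  which yields \<open>x\<^sub>p x\<^sub>q = x\<^sub>p\<^sub>+\<^sub>1 x\<^sub>q\<^sub>-\<^sub>1 + C\<^sub>q\<^sub>-\<^sub>p\<^sub>-\<^sub>2(z)\<close>; with these two relations every product of
  cluster variables is straightened into cluster monomials and powers of \<open>z\<close>. Linear independence
  follows from a rank two valuation which takes every value in \<open>\<int>\<^sup>2\<close> exactly once on either basis.
  The bases differ only in \<open>P\<^sub>n(z)\<close> versus \<open>z\<^sup>n\<close>, and \<open>z P\<^sub>1 = P\<^sub>2 + 2\<close>, \<open>z P\<^sub>n = P\<^sub>n\<^sub>+\<^sub>1 + P\<^sub>n\<^sub>-\<^sub>1\<close> for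
  \<open>n > 1\<close> express \<open>z\<^sup>n\<close> as \<open>P\<^sub>n(z)\<close> plus a non-negative combination of lower terms.\<close>

subsection \<open>A rank two valuation\<close>

definition poly_lead :: "'a::idom poly poly \<Rightarrow> nat \<Rightarrow> nat \<Rightarrow> bool" where
  "poly_lead p i j \<longleftrightarrow> (\<forall>k<i. coeff p k = 0) \<and> coeff p i \<noteq> 0 \<and> degree (coeff p i) = j"

text \<open>For \<open>f\<close> in the ambient field, \<open>lead f a b\<close> says that \<open>f\<close> has order \<open>a\<close> in \<open>u\<^sub>2\<close> and that its
  lowest coefficient has degree \<open>- b\<close> in \<open>u\<^sub>1\<close>. Pairs are compared lexicographically.\<close>

definition lead :: "'a::idom poly poly fract \<Rightarrow> int \<Rightarrow> int \<Rightarrow> bool" where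
  "lead f a b \<longleftrightarrow> (\<exists>p q i j i' j'. poly_lead p i j \<and> poly_lead q i' j' \<and> f = Fract p q \<and>
     a = int i - int i' \<and> b = int j' - int j)"

text \<open>Over a domain the two lowest coefficients have a nonzero product, and their degrees
  add.\<close>

lemma poly_lead_mult:
  assumes "poly_lead p i j" "poly_lead q i' j'"
  shows "poly_lead (p * q) (i + i') (j + j')"
proof -
  \<comment> \<open>In the convolution up to index \<open>i + i'\<close>, only the term
    \<open>k = i\<close> at \<open>n = i + i'\<close> can survive.\<close>
  have z: "coeff p k * coeff q (n - k) = 0" if "n \<le> i + i'" "k \<le> n" "n = i + i' \<longrightarrow> k \<noteq> i" for n k
  proof (cases "k < i")
    case False
    then have "n - k < i'" using that by linarith
    then show ?thesis using assms by (simp add: poly_lead_def)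
  qed (use assms in \<open>simp add: poly_lead_def\<close>)
  have low: "coeff (p * q) n = 0" if "n < i + i'" for n
    unfolding coeff_mult using that z[of n] by (intro sum.neutral) auto
  have "coeff (p * q) (i + i') = (\<Sum>k\<in>{i}. coeff p k * coeff q (i + i' - k))"
    unfolding coeff_mult using z[of "i + i'"] by (intro sum.mono_neutral_right) auto
  then show ?thesis
    using assms low by (auto simp: poly_lead_def degree_mult_eq)
qed

text \<open>The strict comparison excludes cancellation. It is reversed in the degree because
  \<open>lead\<close> counts degrees negatively.\<close>

lemma poly_lead_add:
  assumes "poly_lead p i j" "poly_lead q i' j'" "i < i' \<or> i = i' \<and> j' < j"
  shows "poly_lead (p + q) i j"
proof (cases "i < i'")
  case True
  then show ?thesis using assms by (auto simp: poly_lead_def)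
next
  case False
  then have "i' = i" "j' < j" using assms(3) by auto
  with assms have "degree (coeff q i) < degree (coeff p i)" by (simp add: poly_lead_def)
  then have "degree (coeff p i + coeff q i) = degree (coeff p i)"
    by (rule degree_add_eq_left)
  moreover from this have "coeff p i + coeff q i \<noteq> 0"
    using \<open>degree (coeff q i) < _\<close> by fastforce
  ultimately show ?thesis using assms \<open>i' = i\<close> by (auto simp: poly_lead_def)
qed

lemma poly_lead_nonzero: "poly_lead p i j \<Longrightarrow> p \<noteq> 0"
  by (auto simp: poly_lead_def)

lemma leadI:
  "poly_lead p i j \<Longrightarrow> poly_lead q i' j' \<Longrightarrow> f = Fract p q \<Longrightarrow>
    a = int i - int i' \<Longrightarrow> b = int j' - int j \<Longrightarrow> lead f a b"
  unfolding lead_def by blast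

lemma lead_nonzero: "lead f a b \<Longrightarrow> f \<noteq> 0"
proof -
  assume "lead f a b"
  then obtain p q i j i' j' where *: "poly_lead p i j" "poly_lead q i' j'" "f = Fract p q"
    unfolding lead_def by blast
  have "Fract p q \<noteq> Fract 0 1"
    using *(1,2) by (simp add: eq_fract(1) poly_lead_nonzero)
  then show ?thesis by (simp add: *(3) Zero_fract_def)
qed

lemma lead_mult:
  assumes "lead f a b" "lead g a' b'"
  shows "lead (f * g) (a + a') (b + b')"
proof -
  from assms obtain p q i j k l p' q' i' j' k' l' where
    *: "poly_lead p i j" "poly_lead q k l" "f = Fract p q" "a = int i - int k" "b = int l - int j"
      "poly_lead p' i' j'" "poly_lead q' k' l'" "g = Fract p' q'" "a' = int i' - int k'" "b' = int l' - int j'"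
    unfolding lead_def by blast
  show ?thesis
    by (rule leadI[OF poly_lead_mult[OF *(1,6)] poly_lead_mult[OF *(2,7)]]) (use * in simp_all)
qed

lemma lead_inverse:
  assumes "lead f a b"
  shows "lead (inverse f) (- a) (- b)"
proof -
  from assms obtain p q i j k l where
    *: "poly_lead p i j" "poly_lead q k l" "f = Fract p q" "a = int i - int k" "b = int l - int j"
    unfolding lead_def by blast
  show ?thesis
    by (rule leadI[OF *(2,1)]) (use * in simp_all)
qed

lemma lead_divide:
  "lead f a b \<Longrightarrow> lead g a' b' \<Longrightarrow> lead (f / g) (a - a') (b - b')"
  using lead_mult[OF _ lead_inverse, of f a b g a' b'] by (simp add: divide_inverse)

lemma lead_add:
  assumes "lead f a b" "lead g a' b'" "a < a' \<or> a = a' \<and> b < b'"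
  shows "lead (f + g) a b"
proof -
  from assms obtain p q i j k l p' q' i' j' k' l' where
    *: "poly_lead p i j" "poly_lead q k l" "f = Fract p q" "a = int i - int k" "b = int l - int j"
      "poly_lead p' i' j'" "poly_lead q' k' l'" "g = Fract p' q'" "a' = int i' - int k'" "b' = int l' - int j'"
    unfolding lead_def by blast
  have "poly_lead (p * q' + p' * q) (i + k') (j + l')"
    by (rule poly_lead_add[OF poly_lead_mult poly_lead_mult]) (use * assms(3) in auto)
  then show ?thesis
    by (rule leadI[OF _ poly_lead_mult[OF *(2,7)]]) (use * in \<open>simp_all add: poly_lead_nonzero\<close>)
qed

lemma lead_of_int:
  assumes "c \<noteq> 0"
  shows "lead (of_int c :: 'a::{idom,ring_char_0} poly poly fract) 0 0"
proof -
  have "of_int c = Fract [:[:of_int c:]:] (1 :: 'a poly poly)"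
    by (cases c rule: int_diff_cases)
      (simp add: of_nat_fract of_nat_poly flip: Fract_of_nat_eq One_fract_def)
  moreover have "poly_lead [:[:of_int c :: 'a:]:] 0 0" "poly_lead (1 :: 'a poly poly) 0 0"
    using assms by (auto simp: poly_lead_def)
  ultimately show ?thesis by (intro leadI[of _ 0 0 _ 0 0]) simp_all
qed

lemma lead_uminus: "lead f a b \<Longrightarrow> lead (- f :: 'a::{idom,ring_char_0} poly poly fract) a b"
  using lead_mult[OF lead_of_int[of "-1"], of f a b] by simp

lemma lead_power: "lead f a b \<Longrightarrow> lead (f ^ n :: 'a::{idom,ring_char_0} poly poly fract) (int n * a) (int n * b)"
proof (induction n)
  case 0
  then show ?case using lead_of_int[of 1, where ?'a = 'a] by simp
next
  case (Suc n)
  then show ?case using lead_mult[OF Suc.prems Suc.IH[OF Suc.prems]] by (simp add: algebra_simps)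
qed

text \<open>The terms are indexed by their own valuations, so these are distinct and the least one
  survives. The induction inserts a new minimum each time, which dominates the sum built so
  far.\<close>

lemma lead_sum:
  assumes "finite T" "T \<noteq> {}" "\<And>w. w \<in> T \<Longrightarrow> lead (g w) (fst w) (snd w)"
  shows "\<exists>w\<in>T. lead (sum g T) (fst w) (snd w)"
  using assms
proof (induction rule: finite_linorder_min_induct)
  case empty
  then show ?case by simp
next
  case (insert w T)
  show ?case
  proof (cases "T = {}")
    case False
    then obtain w' where w': "w' \<in> T" "lead (sum g T) (fst w') (snd w')"
      using insert by auto
    then have "w < w'" using insert by auto
    then have "lead (g w + sum g T) (fst w) (snd w)"
      using insert.prems w' by (intro lead_add[OF _ w'(2)]) (auto simp: less_prod_def)
    then show ?thesis using insert by (metis insertI1 less_irrefl sum.insert)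
  qed (use insert in auto)
qed

text \<open>If \<open>E v = E w\<close> with \<open>v \<noteq> w\<close>, then
  \<open>E v - E w\<close> would be a vanishing sum of terms with distinct valuations.\<close>

lemma lead_inj:
  fixes E :: "int \<times> int \<Rightarrow> 'a::{idom,ring_char_0} poly poly fract"
  assumes "\<And>w. lead (E w) (fst w) (snd w)"
  shows "inj E"
proof (rule injI, rule ccontr)
  fix v w assume *: "E v = E w" "v \<noteq> w"
  define g where "g = (\<lambda>u. if u = v then E v else - E w)"
  have "\<exists>u\<in>{v,w}. lead (sum g {v,w}) (fst u) (snd u)"
    using assms lead_uminus[OF assms] by (intro lead_sum) (auto simp: g_def)
  moreover have "sum g {v,w} = 0" using * by (simp add: g_def)
  ultimately show False using lead_nonzero by metis
qed

text \<open>A nontrivial relation, stripped of its zero coefficients, would be a nonempty sum with a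
  valuation, hence nonzero.\<close>

lemma lead_independent:
  fixes E :: "int \<times> int \<Rightarrow> 'a::{idom,ring_char_0} poly poly fract"
  assumes "\<And>w. lead (E w) (fst w) (snd w)"
  shows "\<not> zmod.dependent (range E)"
proof
  assume "zmod.dependent (range E)"
  then obtain t u where tu: "finite t" "t \<subseteq> range E" "(\<Sum>f\<in>t. zscale (u f) f) = 0" "\<exists>f\<in>t. u f \<noteq> 0"
    unfolding zmod.dependent_explicit by blast
  define T where "T = {w. E w \<in> t \<and> u (E w) \<noteq> 0}"
  have inj: "inj E" using lead_inj assms by blast
  have fin: "finite T"
    unfolding T_def using tu(1) inj by (intro finite_subset[OF _ finite_vimageI[of t E]]) auto
  have "T \<noteq> {}" using tu(2,4) unfolding T_def by blast
  have "\<exists>w\<in>T. lead (\<Sum>w\<in>T. zscale (u (E w)) (E w)) (fst w) (snd w)"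
  proof (rule lead_sum[OF fin \<open>T \<noteq> {}\<close>])
    fix w assume "w \<in> T"
    then show "lead (zscale (u (E w)) (E w)) (fst w) (snd w)"
      using lead_mult[OF lead_of_int[of "u (E w)"] assms[of w]] by (simp add: zscale_def T_def)
  qed
  moreover have "(\<Sum>w\<in>T. zscale (u (E w)) (E w)) = (\<Sum>f\<in>E ` T. zscale (u f) f)"
    using inj by (subst sum.reindex) (auto simp: inj_on_def)
  moreover have "\<dots> = (\<Sum>f\<in>t. zscale (u f) f)"
  proof (rule sum.mono_neutral_left)
    show "\<forall>f\<in>t - E ` T. zscale (u f) f = 0"
    proof
      fix f assume f: "f \<in> t - E ` T"
      then obtain w where "f = E w" using tu(2) by blast
      with f have "u f = 0" unfolding T_def by blast
      then show "zscale (u f) f = 0" by (simp add: zscale_def)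
    qed
  qed (use tu(1) in \<open>auto simp: T_def\<close>)
  ultimately show False using tu(3) lead_nonzero by metis
qed


subsection \<open>Chebyshev polynomials\<close>

lemma chebyshev_C_neg: "n < 0 \<Longrightarrow> chebyshev_C n x = 0"
  and chebyshev_C_0: "chebyshev_C 0 x = 1"
  and chebyshev_C_rec: "0 < n \<Longrightarrow> chebyshev_C n x = x * chebyshev_C (n - 1) x - chebyshev_C (n - 2) x"
  by (simp_all add: chebyshev_C.simps[of n] chebyshev_C.simps[of 0])

lemma chebyshev_P_0: "chebyshev_P 0 x = 1"
  by (simp add: chebyshev_P_def chebyshev_C_0 chebyshev_C_neg)

lemma chebyshev_P_1: "chebyshev_P (Suc 0) x = x"
  by (simp add: chebyshev_P_def chebyshev_C_rec chebyshev_C_0 chebyshev_C_neg)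

text \<open>The factor 2 compensates for the normalization \<open>P_0 = 1\<close>, where
  \<open>t^0 + t^(-0)\<close> would give 2.\<close>

lemma chebyshev_P_rec:
  "chebyshev_P (Suc (Suc k)) x = x * chebyshev_P (Suc k) x - (if k = 0 then 2 else 1) * chebyshev_P k x"
proof (cases k)
  case 0
  then show ?thesis
    by (simp add: chebyshev_P_def chebyshev_C_rec chebyshev_C_0 chebyshev_C_neg algebra_simps)
next
  case (Suc j)
  have "chebyshev_C (2 + int k) x = x * chebyshev_C (1 + int k) x - chebyshev_C (int k) x"
    using chebyshev_C_rec[of "2 + int k" x] by simp
  moreover have "chebyshev_C (int k) x = x * chebyshev_C (int k - 1) x - chebyshev_C (int k - 2) x"
    using chebyshev_C_rec[of "int k" x] Suc by simp
  ultimately show ?thesis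
    using Suc by (simp add: chebyshev_P_def right_diff_distrib)
qed

text \<open>In the recursion the product with \<open>y\<close> has the strictly smaller valuation
  and so determines the result.\<close>

lemma lead_chebyshev_P:
  fixes y :: "'a::{idom,ring_char_0} poly poly fract"
  assumes "lead y (-1) (-1)"
  shows "lead (chebyshev_P k y) (- int k) (- int k)"
proof (induction k rule: less_induct)
  case (less k)
  consider "k = 0" | "k = 1" | j where "k = Suc (Suc j)"
    by (metis One_nat_def not0_implies_Suc)
  then show ?case
  proof cases
    case 1
    then show ?thesis using lead_of_int[of 1, where ?'a = 'a] by (simp add: chebyshev_P_0)
  next
    case 2
    then show ?thesis using assms by (simp add: chebyshev_P_1)
  next
    case 3
    define c :: int where "c = (if j = 0 then 2 else 1)"
    have "lead (y * chebyshev_P (Suc j) y) (- int k) (- int k)"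
      using lead_mult[OF assms less.IH[of "Suc j"]] 3 by simp
    moreover have "lead (- (of_int c * chebyshev_P j y)) (- int j) (- int j)"
      using lead_uminus[OF lead_mult[OF lead_of_int less.IH[of j]], of c] 3 by (simp add: c_def)
    ultimately have "lead (y * chebyshev_P (Suc j) y + - (of_int c * chebyshev_P j y)) (- int k) (- int k)"
      by (rule lead_add) (use 3 in auto)
    then show ?thesis by (simp add: 3 chebyshev_P_rec c_def split: if_splits)
  qed
qed


subsection \<open>Cluster variables of the Kronecker quiver\<close>

fun lin_rec :: "'a::comm_ring_1 \<Rightarrow> 'a \<Rightarrow> 'a \<Rightarrow> nat \<Rightarrow> 'a" where
  "lin_rec y a b 0 = a"
| "lin_rec y a b (Suc 0) = b"
| "lin_rec y a b (Suc (Suc n)) = y * lin_rec y a b (Suc n) - lin_rec y a b n"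

text \<open>The recursion is symmetric under reversing the indices, so the same one-sided sequence
  serves both directions, with \<open>u1\<close> and \<open>u2\<close> swapped to the left.\<close>

definition cvar :: "int \<Rightarrow> ambient" where
  "cvar n = (if 1 \<le> n then lin_rec z u1 u2 (nat (n - 1)) else lin_rec z u2 u1 (nat (2 - n)))"

lemma cvar_1: "cvar 1 = u1" and cvar_2: "cvar 2 = u2"
  by (simp_all add: cvar_def)

lemma cvar_rec: "cvar (n + 1) = z * cvar n - cvar (n - 1)"
proof -
  \<comment> \<open>The value \<open>n = 1\<close> is where the two one-sided sequences
    meet.\<close>
  consider "n \<ge> 2" | "n = 1" | "n \<le> 0" by linarith
  then show ?thesis
  proof cases
    case 1
    then have "nat n = Suc (Suc (nat (n - 2)))" "nat (n - 1) = Suc (nat (n - 2))" by auto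
    with 1 show ?thesis by (simp add: cvar_def)
  next
    case 2
    then show ?thesis by (simp add: cvar_def numeral_2_eq_2)
  next
    case 3
    then have "nat (3 - n) = Suc (Suc (nat (1 - n)))" "nat (2 - n) = Suc (nat (1 - n))" by auto
    with 3 show ?thesis by (cases "n = 0") (simp_all add: cvar_def numeral_2_eq_2 numeral_3_eq_3)
  qed
qed

lemma lead_u1: "lead u1 0 (-1)"
  unfolding u1_def by (rule leadI[of _ 0 1 _ 0 0]) (simp_all add: poly_lead_def)

lemma lead_u2: "lead u2 1 0"
  unfolding u2_def by (rule leadI[of _ 1 0 _ 0 0]) (simp_all add: poly_lead_def)

lemma lead_1: "lead (1 :: ambient) 0 0"
  using lead_of_int[of 1, where ?'a = rat] by simp

text \<open>Among the summands of the numerator \<open>u1 ^ 2\<close> has the least valuation, so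
  \<open>z\<close> leads like \<open>u1 / u2\<close>.\<close>

lemma lead_z: "lead z (-1) (-1)"
proof -
  have "lead (u1 ^ 2 + 1) 0 (-2)"
    using lead_add[OF lead_power[OF lead_u1, of 2] lead_1] by simp
  from lead_add[OF this lead_power[OF lead_u2, of 2]]
  have "lead (1 + u1 ^ 2 + u2 ^ 2) 0 (-2)" by (simp add: ac_simps)
  from lead_divide[OF this lead_mult[OF lead_u1 lead_u2]] show ?thesis
    by (simp add: z_def)
qed

text \<open>The Casoratian of the recursion is constant, because the roots of
  \<open>t^2 - y t + 1\<close> have product 1.\<close>

lemma casoratian_step:
  fixes a b c d y :: "'a::comm_ring_1"
  assumes "c = y * b - a" "d = y * c - b"
  shows "b * d - c\<^sup>2 = a * c - b\<^sup>2"
proof -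
  have a: "a = y * b - c" using assms(1) by simp
  show ?thesis unfolding assms(2) a by (simp add: power2_eq_square algebra_simps)
qed

text \<open>The conserved Casoratian equals 1 at \<open>n = 1\<close> by the definition of
  \<open>z\<close>; it is then propagated in both directions.\<close>

lemma exchange: "cvar (n - 1) * cvar (n + 1) = cvar n ^ 2 + 1"
proof (induction n rule: int_induct[of _ 1])
  case base
  have "cvar 0 = z * u1 - u2"
    using cvar_rec[of 1] by (simp add: cvar_1 cvar_2 algebra_simps)
  moreover have "z * (u1 * u2) = 1 + u1 ^ 2 + u2 ^ 2"
    using lead_nonzero[OF lead_u1] lead_nonzero[OF lead_u2] by (simp add: z_def)
  ultimately show ?case
    by (simp add: cvar_1 cvar_2 left_diff_distrib power2_eq_square mult.assoc)
next
  case (step1 n)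
  have "cvar (n + 2) = z * cvar (n + 1) - cvar n"
    using cvar_rec[of "n + 1"] by (simp add: add.commute[of n 2])
  then have "cvar n * cvar (n + 2) - cvar (n + 1) ^ 2 = cvar (n - 1) * cvar (n + 1) - cvar n ^ 2"
    by (rule casoratian_step[OF cvar_rec])
  with step1 show ?case by (simp add: add.commute[of n 2])
next
  case (step2 n)
  have "cvar n = z * cvar (n - 1) - cvar (n - 2)" using cvar_rec[of "n - 1"] by simp
  then have "cvar (n - 2) * cvar n - cvar (n - 1) ^ 2 = cvar (n - 1) * cvar (n + 1) - cvar n ^ 2"
    using casoratian_step[of "cvar n" z "cvar (n - 1)" "cvar (n - 2)"] cvar_rec[of n] by simp
  with step2 show ?case by simp
qed

lemma lead_cvar_left: "n \<le> 2 \<Longrightarrow> lead (cvar n) (n - 1) (n - 2)"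
proof -
  \<comment> \<open>The recursion has order two, so consecutive pairs are carried along. Each step
    to the left adds the valuation (-1, -1) of \<open>z\<close>.\<close>
  have "lead (cvar n) (n - 1) (n - 2) \<and> lead (cvar (n - 1)) (n - 2) (n - 3)" if "n \<le> 2" for n
    using that
  proof (induction n rule: int_le_induct)
    case base
    then show ?case using lead_u1 lead_u2 by (simp add: cvar_1 cvar_2)
  next
    case (step n)
    have "lead (z * cvar (n - 1) + - cvar n) (n - 3) (n - 4)"
    proof (rule lead_add)
      show "lead (z * cvar (n - 1)) (n - 3) (n - 4)"
        using lead_mult[OF lead_z conjunct2[OF step.IH]] by (simp add: algebra_simps)
      show "lead (- cvar n) (n - 1) (n - 2)"
        using step.IH lead_uminus by blast
    qed auto
    moreover have "cvar (n - 2) = z * cvar (n - 1) + - cvar n"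
      using cvar_rec[of "n - 1"] by simp
    ultimately show ?case using step.IH by simp
  qed
  then show "n \<le> 2 \<Longrightarrow> lead (cvar n) (n - 1) (n - 2)" by blast
qed

lemma lead_cvar_right: "3 \<le> n \<Longrightarrow> lead (cvar n) (3 - n) (4 - n)"
proof -
  \<comment> \<open>The exchange relation is used here because in \<open>z * u2 - u1\<close> both
    terms have valuation (0, -1) and their leading parts cancel.\<close>
  have 3: "lead (cvar 3) 0 1"
  proof -
    have "cvar 3 = (1 + u2 ^ 2) / u1"
      using exchange[of 2] lead_nonzero[OF lead_u1] by (simp add: cvar_1 cvar_2 field_simps)
    then show ?thesis
      using lead_divide[OF lead_add[OF lead_1 lead_power[OF lead_u2, of 2]] lead_u1] by simp
  qed
  have 4: "lead (cvar 4) (-1) 0"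
  proof -
    have "cvar 4 = (1 + cvar 3 ^ 2) / u2"
      using exchange[of 3] lead_nonzero[OF lead_u2] by (simp add: cvar_2 field_simps)
    then show ?thesis
      using lead_divide[OF lead_add[OF lead_1 lead_power[OF 3, of 2]] lead_u2] by simp
  qed
  have "lead (cvar n) (3 - n) (4 - n) \<and> lead (cvar (n + 1)) (2 - n) (3 - n)" if "3 \<le> n" for n
    using that
  proof (induction n rule: int_ge_induct)
    case base
    then show ?case using 3 4 by simp
  next
    case (step n)
    have "lead (z * cvar (n + 1) + - cvar n) (1 - n) (2 - n)"
    proof (rule lead_add)
      show "lead (z * cvar (n + 1)) (1 - n) (2 - n)"
        using lead_mult[OF lead_z conjunct2[OF step.IH]] by (simp add: algebra_simps)
      show "lead (- cvar n) (3 - n) (4 - n)"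
        using step.IH lead_uminus by blast
    qed auto
    moreover have "cvar (n + 2) = z * cvar (n + 1) + - cvar n"
      using cvar_rec[of "n + 1"] by (simp add: add.commute[of n 2])
    ultimately show ?case using step.IH by (simp add: add.commute[of n 2])
  qed
  then show "3 \<le> n \<Longrightarrow> lead (cvar n) (3 - n) (4 - n)" by blast
qed

lemma cvar_nonzero: "cvar n \<noteq> 0"
  using lead_nonzero lead_cvar_left[of n] lead_cvar_right[of n] by (cases "n \<le> 2") auto

section \<open>Seeds, cluster variables and cluster monomials\<close>

lemma UNIV_kvertex: "(UNIV :: kvertex set) = {V1, V2}"
  using kvertex.exhaust by auto

text \<open>The cluster is \<open>{cvar n, cvar (n + 1)}\<close>. Odd indices sit at
  \<open>V1\<close> and even ones at \<open>V2\<close>, so neighbouring seeds differ at one vertex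
  only; the matrix changes sign at each mutation.\<close>

definition kseed :: "int \<Rightarrow> (kvertex, ambient) seed" where
  "kseed n =
    (\<lambda>i j. (if odd n then 1 else - 1) * exchange_matrix kronecker_quiver i j,
     if odd n then case_kvertex (cvar n) (cvar (n + 1)) else case_kvertex (cvar (n + 1)) (cvar n))"

lemma kseed_1: "kseed 1 = initial_seed"
  by (simp add: kseed_def initial_seed_def cvar_1 cvar_2)

text \<open>The condition says that \<open>k\<close> carries \<open>cvar n\<close>; mutation there
  produces \<open>cvar (n + 2)\<close>, at the other vertex \<open>cvar (n - 1)\<close>.\<close>

lemma mutate_kseed:
  "mutate k (kseed n) = (if (k = V1) = odd n then kseed (n + 1) else kseed (n - 1))"
proof -
  have ex: "(cvar (n + 1) ^ 2 + 1) / cvar n = cvar (n + 2)"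
    "(1 + cvar (n + 1) ^ 2) / cvar n = cvar (n + 2)"
    "(cvar n ^ 2 + 1) / cvar (n + 1) = cvar (n - 1)"
    "(1 + cvar n ^ 2) / cvar (n + 1) = cvar (n - 1)"
    using exchange[of "n + 1"] exchange[of n] cvar_nonzero[of n] cvar_nonzero[of "n + 1"]
    by (simp_all add: field_simps)
  have mat: "mutate_matrix k (fst (kseed n)) = fst (kseed (n + 1))"
    "fst (kseed (n - 1)) = fst (kseed (n + 1))"
    by (cases k; auto simp: mutate_matrix_def kseed_def exchange_matrix_def kronecker_quiver_def
          fun_eq_iff split: kvertex.splits)+
  have "mutate_cluster k (fst (kseed n)) (snd (kseed n)) =
      snd (if (k = V1) = odd n then kseed (n + 1) else kseed (n - 1))"
    using ex[unfolded add.commute[of n 2]]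
    by (cases k; auto simp: mutate_cluster_def kseed_def exchange_matrix_def kronecker_quiver_def
          UNIV_kvertex fun_eq_iff split: kvertex.splits)
  then show ?thesis
    using mat by (auto simp: mutate_def prod_eq_iff)
qed

lemma seeds_initial_seed: "seeds initial_seed = range kseed"
proof
  show "seeds initial_seed \<subseteq> range kseed"
  proof
    fix s assume "s \<in> seeds initial_seed"
    then show "s \<in> range kseed"
      by induction (auto simp: mutate_kseed simp flip: kseed_1)
  qed
  have "kseed n \<in> seeds initial_seed" for n
  proof (induction n rule: int_induct[of _ 1])
    case base
    then show ?case by (simp add: kseed_1 seeds.initial)
  next
    case (step1 n)
    then show ?case
      using seeds.mutation[of "kseed n" initial_seed "if odd n then V1 else V2"] by (simp add: mutate_kseed split: if_splits)
  next
    case (step2 n)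
    then show ?case
      using seeds.mutation[of "kseed n" initial_seed "if odd n then V2 else V1"] by (simp add: mutate_kseed split: if_splits)
  qed
  then show "range kseed \<subseteq> seeds initial_seed" by blast
qed

lemma cluster_variables_eq: "cluster_variables initial_seed = range cvar"
proof -
  have *: "range (snd (kseed n)) = {cvar n, cvar (n + 1)}" for n
    by (auto simp: kseed_def UNIV_kvertex)
  show ?thesis
    unfolding cluster_variables_def seeds_initial_seed by (auto simp: *)
qed

lemma cluster_monomials_eq:
  "cluster_monomials initial_seed = {cvar n ^ a * cvar (n + 1) ^ b | n a b. True}" (is "?L = ?R")
proof
  show "?L \<subseteq> ?R"
  proof
    fix f assume "f \<in> ?L"
    then obtain n m where f: "f = (\<Prod>i\<in>UNIV. snd (kseed n) i ^ m i)"
      unfolding cluster_monomials_def seeds_initial_seed by blast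
    have "f = cvar n ^ (if odd n then m V1 else m V2) * cvar (n + 1) ^ (if odd n then m V2 else m V1)"
      by (simp add: f UNIV_kvertex kseed_def)
    then show "f \<in> ?R" by blast
  qed
  show "?R \<subseteq> ?L"
  proof
    fix f assume "f \<in> ?R"
    then obtain n a b where f: "f = cvar n ^ a * cvar (n + 1) ^ b" by blast
    have "f = (\<Prod>i\<in>UNIV. snd (kseed n) i ^ (if odd n then case_kvertex a b else case_kvertex b a) i)"
      by (simp add: f UNIV_kvertex kseed_def)
    then show "f \<in> ?L"
      unfolding cluster_monomials_def seeds_initial_seed by blast
  qed
qed


subsection \<open>The bases span the cluster algebra\<close>

text \<open>Multiplication by \<open>y\<close> is linear, so straightening need only be checked on
  generators.\<close>

lemma span_mult:
  fixes c :: "'a::comm_ring_1"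
  assumes "c \<in> zmod.span S" "\<And>s. s \<in> S \<Longrightarrow> s * y \<in> zmod.span T"
  shows "c * y \<in> zmod.span T"
  using assms(1)
proof (induction rule: zmod.span_induct_alt)
  case base
  then show ?case by (simp add: zmod.span_zero)
next
  case (step c s w)
  have "zscale c (s * y) + w * y \<in> zmod.span T"
    using step assms(2) by (intro zmod.span_add zmod.span_scale) auto
  moreover have "(zscale c s + w) * y = zscale c (s * y) + w * y"
    by (simp add: zscale_def distrib_right mult.assoc)
  ultimately show ?case by simp
qed

lemma chebyshev_C_in_span: "chebyshev_C n y \<in> zmod.span (range (\<lambda>k. y ^ k))"
proof (induction n rule: measure_induct_rule[of "\<lambda>n. nat (n + 1)"])
  case (less n)
  consider "n < 0" | "n = 0" | "0 < n" by linarith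
  then show ?case
  proof cases
    case 1
    then show ?thesis by (simp add: chebyshev_C_neg zmod.span_zero)
  next
    case 2
    then show ?thesis
      by (simp add: chebyshev_C_0) (metis power_0 rangeI zmod.span_base)
  next
    case 3
    have "chebyshev_C (n - 1) y * y \<in> zmod.span (range (\<lambda>k. y ^ k))"
    proof (rule span_mult[OF less.IH])
      fix s assume "s \<in> range (\<lambda>k. y ^ k)"
      then obtain k where "s * y = y ^ Suc k" by (metis imageE power_Suc2)
      then show "s * y \<in> zmod.span (range (\<lambda>k. y ^ k))"
        by (metis rangeI zmod.span_base)
    qed (use 3 in auto)
    with 3 less.IH[of "n - 2"] show ?thesis
      by (simp add: chebyshev_C_rec zmod.span_diff mult.commute)
  qed
qed

text \<open>For fixed \<open>p\<close> the difference of the two products satisfies in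
  \<open>k\<close> the recursion of \<open>chebyshev_C\<close>. The initial values agree: 0 at
  \<open>k = -1\<close> by commutativity, 1 at \<open>k = 0\<close> by
  \<open>exchange\<close>.\<close>

lemma straighten:
  "cvar p * cvar (p + 2 + int k) = cvar (p + 1) * cvar (p + 1 + int k) + chebyshev_C (int k) z"
proof -
  define D where "D = (\<lambda>k. cvar p * cvar (p + 2 + k) - cvar (p + 1) * cvar (p + 1 + k))"
  have rec: "D (k + 1) = z * D k - D (k - 1)" for k
  proof -
    have c: "cvar (n + (k + 1)) = z * cvar (n + k) - cvar (n + (k - 1))" for n
      using cvar_rec[of "n + k"] by (simp add: add.assoc add_diff_eq)
    show ?thesis unfolding D_def c by (simp add: algebra_simps)
  qed
  have "D (int k - 1) = chebyshev_C (int k - 1) z \<and> D (int k) = chebyshev_C (int k) z"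
  proof (induction k)
    case 0
    then show ?case
      using exchange[of "p + 1"]
      by (simp add: D_def chebyshev_C_neg chebyshev_C_0 power2_eq_square add.commute)
  next
    case (Suc k)
    then show ?case
      using rec[of "int k"] chebyshev_C_rec[of "int k + 1" z] by (simp add: add.commute)
  qed
  then show ?thesis by (simp add: D_def algebra_simps)
qed

text \<open>Since \<open>z * cvar m = cvar (m + 1) + cvar (m - 1)\<close>, powers of
  \<open>z\<close> are absorbed into one cluster variable without raising the degree.\<close>

lemma z_power_cvar_in_span: "z ^ j * cvar n \<in> zmod.span (range cvar)"
proof (induction j)
  case 0
  then show ?case by (simp add: zmod.span_base)
next
  case (Suc j)
  have "z ^ j * cvar n * z \<in> zmod.span (range cvar)"
  proof (rule span_mult[OF Suc])
    fix s assume "s \<in> range cvar"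
    then obtain m where "s = cvar m" by blast
    then have "s * z = cvar (m + 1) + cvar (m - 1)" using cvar_rec[of m] by simp
    then show "s * z \<in> zmod.span (range cvar)"
      by (simp add: zmod.span_add zmod.span_base)
  qed
  then show ?case by (simp add: ac_simps)
qed

lemma cvar_monomial_near:
  assumes "set_mset N \<subseteq> {n, n + 1}"
  shows "\<exists>a b. prod_mset (image_mset cvar N) = cvar n ^ a * cvar (n + 1) ^ b"
  using assms
proof (induction N)
  case empty
  have "prod_mset (image_mset cvar {#}) = cvar n ^ 0 * cvar (n + 1) ^ 0" by simp
  then show ?case by blast
next
  case (add m N)
  then obtain a b where "prod_mset (image_mset cvar N) = cvar n ^ a * cvar (n + 1) ^ b" by auto
  then have "prod_mset (image_mset cvar (add_mset m N)) =
      (if m = n then cvar n ^ Suc a * cvar (n + 1) ^ b else cvar n ^ a * cvar (n + 1) ^ Suc b)"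
    using add.prems by (auto simp: ac_simps)
  then show ?case by (metis (full_types))
qed

lemma z_power_in_span: "z ^ j \<in> zmod.span semicanonical_basis"
proof (cases j)
  case 0
  have "(1 :: ambient) = cvar 0 ^ 0 * cvar (0 + 1) ^ 0" by simp
  then have "1 \<in> cluster_monomials initial_seed"
    unfolding cluster_monomials_eq by blast
  with 0 show ?thesis by (simp add: semicanonical_basis_def zmod.span_base)
next
  case (Suc k)
  then have "z ^ j \<in> semicanonical_basis"
    unfolding semicanonical_basis_def by (intro UnI2 CollectI exI[of _ j]) simp
  then show ?thesis by (rule zmod.span_base)
qed

text \<open>Moving two indices at distance at least 2 in a product of cluster variables towards each
  other decreases the sum of the squares of the indices, up to terms of smaller degree.\<close>

lemma cvar_product_in_span:
  "prod_mset (image_mset cvar N) \<in> zmod.span semicanonical_basis"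
proof (induction N rule: wf_induct[OF wf_measures[of "[size, \<lambda>N. \<Sum>n\<in>#N. nat (n ^ 2)]"]])
  case (1 N)
  let ?W = "zmod.span semicanonical_basis"
  let ?x = "\<lambda>N. prod_mset (image_mset cvar N)"
  have IH1: "?x M \<in> ?W" if "size M < size N" for M
    using 1 that by auto
  have IH2: "?x M \<in> ?W" if "size M = size N" "(\<Sum>n\<in>#M. nat (n ^ 2)) < (\<Sum>n\<in>#N. nat (n ^ 2))" for M
    using 1 that by auto
  show ?case
  proof (cases "\<exists>p q. p \<in># N \<and> q \<in># N \<and> p + 2 \<le> q")
    case True
    then obtain p q where pq: "p \<in># N" "q \<in># N" "p + 2 \<le> q" by blast
    then have "q \<in># N - {#p#}" by (metis insert_DiffM insert_noteq_member add_le_same_cancel1 not_numeral_le_zero)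
    with pq(1) obtain R where R: "N = add_mset p (add_mset q R)"
      by (metis insert_DiffM)
    define k where "k = nat (q - p - 2)"
    have k: "q = p + 2 + int k" using pq by (simp add: k_def)
    have "?x (add_mset (p + 1) (add_mset (q - 1) R)) \<in> ?W"
    proof (rule IH2)
      \<comment> \<open>The difference of the two sides is \<open>2 * (q - p - 1)\<close>.\<close>
      have "(p + 1)\<^sup>2 + (q - 1)\<^sup>2 < p\<^sup>2 + q\<^sup>2"
        using pq(3) by (simp add: power2_eq_square algebra_simps)
      moreover from this have "0 < p\<^sup>2 + q\<^sup>2"
        by (rule le_less_trans[rotated]) simp
      ultimately have "nat ((p + 1)\<^sup>2) + nat ((q - 1)\<^sup>2) < nat (p\<^sup>2) + nat (q\<^sup>2)"
        by (simp flip: nat_add_distrib)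
      then show "(\<Sum>n\<in>#add_mset (p + 1) (add_mset (q - 1) R). nat (n ^ 2)) < (\<Sum>n\<in>#N. nat (n ^ 2))"
        by (simp add: R)
    qed (simp add: R)
    \<comment> \<open>If \<open>R\<close> is empty, only powers of \<open>z\<close> remain.
      Otherwise one factor of \<open>R\<close> absorbs them, leaving products with two factors fewer
      than \<open>N\<close>.\<close>
    moreover have "chebyshev_C (int k) z * ?x R \<in> ?W"
    proof (rule span_mult[OF chebyshev_C_in_span])
      fix s assume "s \<in> range (\<lambda>k. z ^ k)"
      then obtain j where s: "s = z ^ j" by blast
      show "s * ?x R \<in> ?W"
      proof (cases R)
        case empty
        then show ?thesis by (simp add: s z_power_in_span)
      next
        case (add r R')
        have "(z ^ j * cvar r) * ?x R' \<in> ?W"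
        proof (rule span_mult[OF z_power_cvar_in_span])
          fix t assume "t \<in> range cvar"
          then obtain m where "t = cvar m" by blast
          then show "t * ?x R' \<in> ?W" using IH1[of "add_mset m R'"] by (simp add: R add)
        qed
        then show ?thesis by (simp add: s add ac_simps)
      qed
    qed
    ultimately have "?x (add_mset (p + 1) (add_mset (q - 1) R)) + chebyshev_C (int k) z * ?x R \<in> ?W"
      by (rule zmod.span_add)
    also have "?x (add_mset (p + 1) (add_mset (q - 1) R)) + chebyshev_C (int k) z * ?x R
        = (cvar (p + 1) * cvar (p + 1 + int k) + chebyshev_C (int k) z) * ?x R"
      by (simp add: k distrib_right mult.assoc add.commute add.left_commute)
    also have "\<dots> = ?x N"
      unfolding straighten[symmetric] by (simp add: R k mult.assoc)
    finally show ?thesis .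
  next
    case near: False
    \<comment> \<open>Without two indices at distance at least 2, all lie in
      \<open>{n, n + 1}\<close> for the smallest index \<open>n\<close>, so the product is a cluster
      monomial.\<close>
    have "\<exists>n. set_mset N \<subseteq> {n, n + 1}"
    proof (cases "N = {#}")
      case False
      define n where "n = Min (set_mset N)"
      have "n \<in># N" using False by (simp add: n_def)
      have "m = n \<or> m = n + 1" if "m \<in># N" for m
      proof -
        have "n \<le> m" using that by (simp add: n_def)
        moreover have "\<not> n + 2 \<le> m" using near \<open>n \<in># N\<close> that by blast
        ultimately show ?thesis by linarith
      qed
      then show ?thesis by blast
    qed simp
    then obtain n a b where "?x N = cvar n ^ a * cvar (n + 1) ^ b"
      using cvar_monomial_near by blast
    then have "?x N \<in> semicanonical_basis"
      unfolding semicanonical_basis_def cluster_monomials_eq by blast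
    then show ?thesis by (rule zmod.span_base)
  qed
qed

text \<open>The span is stable under the whole algebra; \<open>w\<close> stays arbitrary so that the
  product case can apply both hypotheses in turn. Taking \<open>w = 1\<close> later gives that the
  algebra lies in the span.\<close>

lemma cluster_algebra_mult_span:
  assumes "f \<in> cluster_algebra initial_seed" "w \<in> zmod.span semicanonical_basis"
  shows "f * w \<in> zmod.span semicanonical_basis"
  using assms
proof (induction arbitrary: w)
  case (variable x)
  then obtain m where x: "x = cvar m" by (auto simp: cluster_variables_eq)
  have "w * x \<in> zmod.span semicanonical_basis"
  proof (rule span_mult[OF variable.prems])
    fix s assume "s \<in> semicanonical_basis"
    then consider n a b where "s = cvar n ^ a * cvar (n + 1) ^ b" | j where "s = z ^ j"
      by (auto simp: semicanonical_basis_def cluster_monomials_eq)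
    then show "s * x \<in> zmod.span semicanonical_basis"
    proof cases
      case 1
      then show ?thesis
        using cvar_product_in_span[of "add_mset m (replicate_mset a n + replicate_mset b (n + 1))"]
        by (simp add: x ac_simps)
    next
      case 2
      have "z ^ j * cvar m * 1 \<in> zmod.span semicanonical_basis"
        by (rule span_mult[OF z_power_cvar_in_span]) (use cvar_product_in_span[of "{#_#}"] in auto)
      then show ?thesis by (simp add: x 2)
    qed
  qed
  then show ?case by (simp add: mult.commute)
next
  case (mult x y)
  then show ?case by (simp add: mult.assoc)
qed (simp_all add: left_diff_distrib zmod.span_diff)

section \<open>The cluster algebra as a module over the integers\<close>

lemma cluster_algebra_0: "0 \<in> cluster_algebra s"
  using cluster_algebra.diff[OF cluster_algebra.one cluster_algebra.one] by simp

lemma cluster_algebra_add: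
  "x \<in> cluster_algebra s \<Longrightarrow> y \<in> cluster_algebra s \<Longrightarrow> x + y \<in> cluster_algebra s"
  using cluster_algebra.diff[OF _ cluster_algebra.diff[OF cluster_algebra_0], of x s y] by simp

lemma cluster_algebra_of_int: "of_int c \<in> cluster_algebra s"
  by (induction c rule: int_induct[of _ 0])
    (simp_all add: cluster_algebra_0 cluster_algebra_add cluster_algebra.one cluster_algebra.diff)

lemma cluster_algebra_power: "x \<in> cluster_algebra s \<Longrightarrow> x ^ n \<in> cluster_algebra s"
  by (induction n) (simp_all add: cluster_algebra.one cluster_algebra.mult)

lemma subspace_cluster_algebra: "zmod.subspace (cluster_algebra s)"
  by (rule zmod.subspaceI)
    (simp_all add: cluster_algebra_0 cluster_algebra_add zscale_def cluster_algebra.mult cluster_algebra_of_int)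

lemma z_in_cluster_algebra: "z \<in> cluster_algebra initial_seed"
proof -
  \<comment> \<open>This is straightening at distance 3, where the correction term is
    \<open>C_1(z) = z\<close>.\<close>
  have "z = cvar 0 * cvar 3 - cvar 1 * cvar 2"
    using straighten[of 0 1] by (simp add: chebyshev_C_rec chebyshev_C_0 chebyshev_C_neg)
  moreover have "cvar n \<in> cluster_algebra initial_seed" for n
    by (rule cluster_algebra.variable) (simp add: cluster_variables_eq)
  ultimately show ?thesis
    by (metis cluster_algebra.diff cluster_algebra.mult)
qed

lemma span_semicanonical_basis:
  "zmod.span semicanonical_basis = cluster_algebra initial_seed"
proof
  have "cvar n \<in> cluster_algebra initial_seed" for n
    by (rule cluster_algebra.variable) (simp add: cluster_variables_eq)
  then have "semicanonical_basis \<subseteq> cluster_algebra initial_seed"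
    by (auto simp: semicanonical_basis_def cluster_monomials_eq z_in_cluster_algebra
          intro!: cluster_algebra.mult cluster_algebra_power)
  then show "zmod.span semicanonical_basis \<subseteq> cluster_algebra initial_seed"
    by (rule zmod.span_minimal) (rule subspace_cluster_algebra)
  show "cluster_algebra initial_seed \<subseteq> zmod.span semicanonical_basis"
    using cluster_algebra_mult_span[of _ 1] z_power_in_span[of 0] by fastforce
qed


subsection \<open>Parametrization by the lattice of leading exponents\<close>

text \<open>The parameters are total degree \<open>d\<close> and second exponent \<open>b\<close>,
  as Euclidean division by \<open>d\<close> delivers them: the quotient fixes the cluster and the
  remainder is \<open>b\<close>.\<close>

definition cmon :: "int \<Rightarrow> int \<Rightarrow> int \<Rightarrow> ambient" where
  "cmon n d b = cvar n ^ nat (d - b) * cvar (n + 1) ^ nat b"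

text \<open>\<open>pointed Q (i, j)\<close> is the basis element with valuation \<open>(i, j)\<close>, where \<open>Q k\<close> is the one chosen
  for \<open>(- k, - k)\<close>. The cases are the cones of the g-vector fan: the ray of \<open>z\<close>, the cluster
  \<open>(x\<^sub>2, x\<^sub>3)\<close>, and the clusters to the left and to the right of it.\<close>

fun pointed :: "(nat \<Rightarrow> ambient) \<Rightarrow> int \<times> int \<Rightarrow> ambient" where
  "pointed Q (i, j) =
    (if i = j \<and> i \<le> 0 then Q (nat (- i))
     else if 0 < i \<and> 0 \<le> j then cmon 2 (i + j) j
     else if j < i then cmon (i div (i - j) + 1) (i - j) (i mod (i - j))
     else cmon ((- i) div (j - i) + 3) (j - i) ((- i) mod (j - i)))"

declare pointed.simps [simp del]

lemma lead_pointed: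
  assumes "\<And>k. lead (Q k) (- int k) (- int k)"
  shows "lead (pointed Q w) (fst w) (snd w)"
proof (cases w)
  case (Pair i j)
  note ij = this
  consider "i = j" "i \<le> 0" | "0 < i" "0 \<le> j" | "j < i" "j < 0" | "i < j" "i \<le> 0" by linarith
  then show ?thesis
  proof cases
    case 1
    then show ?thesis using assms[of "nat (- i)"] by (simp add: ij pointed.simps)
  next
    case 2
    then have "pointed Q w = cmon 2 (i + j) j" by (simp add: ij pointed.simps)
    with 2 show ?thesis
      using lead_mult[OF lead_power[OF lead_cvar_left[of 2], of "nat i"] lead_power[OF lead_cvar_right[of 3], of "nat j"]]
      by (simp add: ij cmon_def)
  next
    case 3
    define d n b where "d = i - j" and "n = i div d + 1" and "b = i mod d"
    have i: "i = (n - 1) * d + b" by (simp add: n_def b_def)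
    have d: "0 < d" using 3 by (simp add: d_def)
    then have b: "0 \<le> b" "b < d" by (simp_all add: b_def)
    \<comment> \<open>Here \<open>j < 0\<close> means \<open>i < d\<close>. The resulting
      \<open>n \<le> 1\<close> puts both \<open>n\<close> and \<open>n + 1\<close> in the range of
      \<open>lead_cvar_left\<close>.\<close>
    have "n * d \<le> d"
      using 3 i b d by (smt (verit) d_def left_diff_distrib mult_le_cancel_right mult_cancel_right2 zero_less_mult_iff mult_less_cancel_right)
    then have n: "n \<le> 1" using d by simp
    from n have "lead (cvar n ^ nat (d - b) * cvar (n + 1) ^ nat b)
        (int (nat (d - b)) * (n - 1) + int (nat b) * (n + 1 - 1))
        (int (nat (d - b)) * (n - 2) + int (nat b) * (n + 1 - 2))"
      by (intro lead_mult lead_power lead_cvar_left) auto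
    moreover have "int (nat (d - b)) * (n - 1) + int (nat b) * (n + 1 - 1) = i"
      using b by (simp add: i algebra_simps)
    moreover have "int (nat (d - b)) * (n - 2) + int (nat b) * (n + 1 - 2) = i - d"
      using b by (simp add: i algebra_simps)
    moreover have "pointed Q w = cmon n d b"
      using 3 by (simp add: ij pointed.simps d_def n_def b_def)
    ultimately show ?thesis by (simp add: ij d_def cmon_def)
  next
    case 4
    define d n b where "d = j - i" and "n = (- i) div d + 3" and "b = (- i) mod d"
    have i: "- i = (n - 3) * d + b" by (simp add: n_def b_def)
    have d: "0 < d" using 4 by (simp add: d_def)
    then have b: "0 \<le> b" "b < d" by (simp_all add: b_def)
    have n: "3 \<le> n" using d 4 by (simp add: n_def pos_imp_zdiv_nonneg_iff)
    from n have "lead (cvar n ^ nat (d - b) * cvar (n + 1) ^ nat b)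
        (int (nat (d - b)) * (3 - n) + int (nat b) * (3 - (n + 1)))
        (int (nat (d - b)) * (4 - n) + int (nat b) * (4 - (n + 1)))"
      by (intro lead_mult lead_power lead_cvar_right) auto
    moreover have "int (nat (d - b)) * (3 - n) + int (nat b) * (3 - (n + 1)) = i"
      using b i by (simp add: algebra_simps)
    moreover have "int (nat (d - b)) * (4 - n) + int (nat b) * (4 - (n + 1)) = i + d"
      using b i by (simp add: algebra_simps)
    moreover have "pointed Q w = cmon n d b"
      using 4 by (simp add: ij pointed.simps d_def n_def b_def)
    ultimately show ?thesis by (simp add: ij d_def cmon_def)
  qed
qed

text \<open>With \<open>0 < a\<close> the exponent \<open>b\<close> is smaller than the total
  degree, so it is a genuine remainder and division recovers \<open>n\<close> and
  \<open>b\<close>.\<close>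

lemma cluster_monomial_pointed:
  assumes "0 < a"
  shows "cvar n ^ a * cvar (n + 1) ^ b \<in> range (pointed Q)"
proof -
  define d where "d = int a + int b"
  have d: "0 < d" "int b < d" using assms by (simp_all add: d_def)
  have cmon: "cvar n ^ a * cvar (n + 1) ^ b = cmon n d (int b)"
    by (simp add: cmon_def d_def)
  consider "n \<le> 1" | "n = 2" | "3 \<le> n" by linarith
  then show ?thesis
  proof cases
    case 1
    define i where "i = (n - 1) * d + int b"
    have "i div d = n - 1" "i mod d = int b" using d by (simp_all add: i_def)
    moreover have "i < d"
      using 1 d mult_right_mono[of "n - 1" 0 d] by (simp add: i_def)
    ultimately have "pointed Q (i, i - d) = cmon n d (int b)"
      using d by (simp add: pointed.simps)
    then show ?thesis unfolding cmon by (metis rangeI)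
  next
    case 2
    then have "pointed Q (int a, int b) = cmon n d (int b)"
      using assms by (simp add: pointed.simps d_def)
    then show ?thesis unfolding cmon by (metis rangeI)
  next
    case 3
    define i where "i = (n - 3) * d + int b"
    have "i div d = n - 3" "i mod d = int b" using d by (simp_all add: i_def)
    moreover have "0 \<le> i"
      using 3 d by (simp add: i_def)
    ultimately have "pointed Q (- i, - i + d) = cmon n d (int b)"
      using d by (simp add: pointed.simps)
    then show ?thesis unfolding cmon by (metis rangeI)
  qed
qed

lemma range_pointed:
  assumes "Q 0 = 1"
  shows "range (pointed Q) = cluster_monomials initial_seed \<union> {Q k | k. k \<ge> 1}" (is "_ = ?S")
proof
  have mono: "cvar n ^ a * cvar (n + 1) ^ b \<in> ?S" for n a b
    by (auto simp: cluster_monomials_eq)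
  have one: "1 \<in> ?S" using mono[of 0 0 0] by simp
  have Q: "Q k \<in> ?S" for k using one assms by (cases "k = 0") auto
  have cmon: "cmon n d b \<in> ?S" for n d b
    unfolding cmon_def by (rule mono)
  show "range (pointed Q) \<subseteq> ?S"
  proof (rule image_subsetI)
    fix w
    show "pointed Q w \<in> ?S"
      by (cases w) (simp only: pointed.simps cmon Q split: if_split, simp)
  qed
  show "?S \<subseteq> range (pointed Q)"
  proof
    fix f assume "f \<in> ?S"
    then consider n a b where "f = cvar n ^ a * cvar (n + 1) ^ b" | k where "f = Q k"
      by (auto simp: cluster_monomials_eq)
    then show "f \<in> range (pointed Q)"
    proof cases
      case 1
      show ?thesis
      proof (cases "a = 0")
        case False
        then show ?thesis using cluster_monomial_pointed[of a n b Q] 1 by simp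
      next
        \<comment> \<open>A power of \<open>cvar (n + 1)\<close> alone is read in the next cluster;
          the monomial 1 is the value \<open>Q 0\<close> at the origin.\<close>
        case True
        note a = this
        show ?thesis
        proof (cases "b = 0")
          case False
          then show ?thesis using cluster_monomial_pointed[of b "n + 1" 0 Q] 1 a by simp
        next
          case True
          then have "f = pointed Q (0, 0)" using 1 a assms by (simp add: pointed.simps)
          then show ?thesis by blast
        qed
      qed
    next
      case 2
      then have "f = pointed Q (- int k, - int k)" by (simp add: pointed.simps)
      then show ?thesis by blast
    qed
  qed
qed


subsection \<open>Unitriangular base changes\<close>

text \<open>Each further factor pushes the possibly nonzero entries one more diagonal away from the
  main one.\<close>

lemma strictly_upper_triangular_pow:
  fixes A :: "'a::semiring_1 mat"
  assumes "A \<in> carrier_mat n n" "\<And>i j. i < n \<Longrightarrow> j < n \<Longrightarrow> j \<le> i \<Longrightarrow> A $$ (i, j) = 0"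
    "i < n" "j < n" "j < i + r"
  shows "(A ^\<^sub>m r) $$ (i, j) = 0"
  using assms(4,5)
proof (induction r arbitrary: j)
  case 0
  then show ?case using assms(1,3) by simp
next
  case (Suc r)
  have "(A ^\<^sub>m Suc r) $$ (i, j) = (\<Sum>k<n. (A ^\<^sub>m r) $$ (i, k) * A $$ (k, j))"
    using assms(1,3) Suc.prems by (auto simp: scalar_prod_def atLeast0LessThan intro!: sum.cong)
  also have "\<dots> = 0"
  proof (rule sum.neutral, rule ballI)
    fix k assume "k \<in> {..<n}"
    then show "(A ^\<^sub>m r) $$ (i, k) * A $$ (k, j) = 0"
      using Suc.IH[of k] assms(2)[of k j] Suc.prems by (cases "k < i + r") auto
  qed
  finally show ?case .
qed

lemma unipotent_mat_unitriangular:
  assumes "M \<in> carrier_mat n n" "\<And>i. i < n \<Longrightarrow> M $$ (i, i) = 1"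
    "\<And>i j. i < n \<Longrightarrow> j < i \<Longrightarrow> M $$ (i, j) = 0"
  shows "unipotent_mat M"
proof -
  have "(M - 1\<^sub>m n) ^\<^sub>m n = 0\<^sub>m n n"
  proof (rule eq_matI)
    fix i j assume "i < dim_row (0\<^sub>m n n :: int mat)" "j < dim_col (0\<^sub>m n n :: int mat)"
    then show "((M - 1\<^sub>m n) ^\<^sub>m n) $$ (i, j) = 0\<^sub>m n n $$ (i, j)"
      using assms by (subst strictly_upper_triangular_pow[of _ n]) (auto simp: le_less)
  qed (use assms(1) in \<open>auto simp: pow_mat_dim_square\<close>)
  then show ?thesis
    using assms(1) unfolding unipotent_mat_def by auto
qed

lemma unitriangular_base_change:
  fixes a b :: "nat \<Rightarrow> 'a::comm_ring_1" and m :: "nat \<Rightarrow> nat \<Rightarrow> int"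
  assumes b: "\<And>k. b k = (\<Sum>i\<le>k. zscale (m i k) (a i))"
    and diag: "\<And>k. m k k = 1" and lower: "\<And>i k. k < i \<Longrightarrow> m i k = 0" and nonneg: "\<And>i k. 0 \<le> m i k"
  shows "zmod.span (a ` {..n}) = zmod.span (b ` {..n})"
    and "\<exists>M. base_change_matrix a b n M \<and> unipotent_mat M \<and> nonneg_mat M"
proof -
  \<comment> \<open>Back substitution: the diagonal entry 1 lets \<open>a k\<close> be solved for
    from \<open>b k\<close> and earlier \<open>a i\<close>.\<close>
  have a_in: "a k \<in> zmod.span (b ` {..n})" if "k \<le> n" for k
    using that
  proof (induction k rule: less_induct)
    case (less k)
    have "b k = a k + (\<Sum>i<k. zscale (m i k) (a i))"
      unfolding b by (simp add: diag zscale_def flip: lessThan_Suc_atMost)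
    then have "a k = b k - (\<Sum>i<k. zscale (m i k) (a i))" by simp
    moreover have "\<dots> \<in> zmod.span (b ` {..n})"
      using less by (intro zmod.span_diff zmod.span_sum zmod.span_scale) (auto intro: zmod.span_base)
    ultimately show ?case by simp
  qed
  have b_in: "b k \<in> zmod.span (a ` {..n})" if "k \<le> n" for k
    unfolding b using that by (intro zmod.span_sum zmod.span_scale zmod.span_base) auto
  show "zmod.span (a ` {..n}) = zmod.span (b ` {..n})"
    unfolding zmod.span_eq using a_in b_in by auto
  define M where "M = mat (Suc n) (Suc n) (\<lambda>(i, k). m i k)"
  have "base_change_matrix a b n M"
    unfolding base_change_matrix_def
  proof (intro conjI allI impI)
    fix k assume "k \<le> n"
    then have "b k = (\<Sum>i\<le>n. zscale (m i k) (a i))"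
      unfolding b by (intro sum.mono_neutral_left) (auto simp: lower zscale_def)
    then show "b k = (\<Sum>i\<le>n. zscale (M $$ (i, k)) (a i))"
      using \<open>k \<le> n\<close> by (simp add: M_def)
  qed (simp add: M_def)
  moreover have "unipotent_mat M"
    by (rule unipotent_mat_unitriangular[of _ "Suc n"]) (auto simp: M_def diag lower)
  moreover have "nonneg_mat M"
    by (auto simp: nonneg_mat_def M_def nonneg)
  ultimately show "\<exists>M. base_change_matrix a b n M \<and> unipotent_mat M \<and> nonneg_mat M"
    by blast
qed


subsection \<open>Powers in terms of Chebyshev polynomials of the first kind\<close>

text \<open>This is the coefficient of \<open>t^k\<close> in \<open>(t + 1/t)^n\<close>: the
  binomial coefficient of \<open>n\<close> over \<open>(n - k)/2\<close> if \<open>k \<le> n\<close>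
  have equal parity, and 0 otherwise.\<close>

fun cheb_coeff :: "nat \<Rightarrow> nat \<Rightarrow> int" where
  "cheb_coeff 0 k = (if k = 0 then 1 else 0)"
| "cheb_coeff (Suc n) 0 = 2 * cheb_coeff n 1"
| "cheb_coeff (Suc n) (Suc k) = cheb_coeff n k + cheb_coeff n (Suc (Suc k))"

lemma cheb_coeff_nonneg: "0 \<le> cheb_coeff n k"
  by (induction n k rule: cheb_coeff.induct) auto

lemma cheb_coeff_eq_0: "n < k \<Longrightarrow> cheb_coeff n k = 0"
  by (induction n k rule: cheb_coeff.induct) auto

lemma cheb_coeff_diag: "cheb_coeff n n = 1"
  by (induction n) (simp_all add: cheb_coeff_eq_0)

lemma power_eq_chebyshev_P:
  "y ^ n = (\<Sum>k\<le>n. of_int (cheb_coeff n k) * chebyshev_P k (y :: 'a::comm_ring_1))"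
proof (induction n)
  case 0
  then show ?case by (simp add: chebyshev_P_0)
next
  case (Suc n)
  let ?P = "\<lambda>k. chebyshev_P k y" and ?c = "\<lambda>k. of_int (cheb_coeff n k) :: 'a"
  have low: "y * ?P 0 = ?P (Suc 0)" by (simp add: chebyshev_P_0 chebyshev_P_1)
  have high: "y * ?P (Suc k) = ?P (Suc (Suc k)) + (if k = 0 then 2 else 1) * ?P k" for k
    by (simp add: chebyshev_P_rec)
  \<comment> \<open>The sum is padded by a zero term so that its \<open>k = 0\<close> summand, which
    obeys a different rule, can be split off.\<close>
  have "y ^ Suc n = y * (\<Sum>k\<le>Suc n. ?c k * ?P k)"
    by (simp add: Suc cheb_coeff_eq_0)
  also have "\<dots> = ?c 0 * (y * ?P 0) + (\<Sum>k\<le>n. ?c (Suc k) * (y * ?P (Suc k)))"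
    unfolding sum.atMost_Suc_shift by (simp add: distrib_left sum_distrib_left ac_simps)
  also have "\<dots> = (?c 0 * ?P (Suc 0) + (\<Sum>k\<le>n. ?c (Suc k) * ?P (Suc (Suc k))))
      + (\<Sum>k\<le>n. ?c (Suc k) * ((if k = 0 then 2 else 1) * ?P k))"
    unfolding low high by (simp add: distrib_left sum.distrib ac_simps)
  also have "?c 0 * ?P (Suc 0) + (\<Sum>k\<le>n. ?c (Suc k) * ?P (Suc (Suc k))) = (\<Sum>k\<le>Suc n. ?c k * ?P (Suc k))"
    unfolding sum.atMost_Suc_shift ..
  also have "\<dots> = (\<Sum>k\<le>n. ?c k * ?P (Suc k))"
    by (simp add: cheb_coeff_eq_0)
  also have "(\<Sum>k\<le>n. ?c (Suc k) * ((if k = 0 then 2 else 1) * ?P k))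
      = (\<Sum>k\<le>Suc n. ?c (Suc k) * ((if k = 0 then 2 else 1) * ?P k))"
    by (simp add: cheb_coeff_eq_0)
  also have "\<dots> = 2 * ?c 1 * ?P 0 + (\<Sum>k\<le>n. ?c (Suc (Suc k)) * ?P (Suc k))"
    unfolding sum.atMost_Suc_shift by simp
  also have "(\<Sum>k\<le>n. ?c k * ?P (Suc k)) + \<dots>
      = (\<Sum>k\<le>Suc n. of_int (cheb_coeff (Suc n) k) * ?P k)"
    unfolding sum.atMost_Suc_shift by (simp add: distrib_left sum.distrib ac_simps)
  finally show ?case .
qed


subsection \<open>The enumerations\<close>

text \<open>The exponents \<open>(- k, - k)\<close>, at which the two bases differ, are enumerated by increasing \<open>k\<close>.\<close>

lemma exponent_enumeration:
  "\<exists>e. bij e \<and> (\<forall>k. e (2 * k) = (- int k, - int k)) \<and>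
     (\<forall>i Q Q'. odd i \<longrightarrow> pointed Q (e i) = pointed Q' (e i))"
proof -
  define d :: "nat \<Rightarrow> int \<times> int" where "d = (\<lambda>k. (- int k, - int k))"
  \<comment> \<open>The ray fills the even positions and its infinite complement \<open>C\<close>
    the odd ones.\<close>
  define C where "C = - range d"
  have "infinite C"
  proof (rule infinite_super)
    show "range (\<lambda>k. (int k, - 1)) \<subseteq> C" by (auto simp: C_def d_def)
    show "infinite (range (\<lambda>k. (int k, - 1 :: int)))"
      by (rule range_inj_infinite) (simp add: inj_def)
  qed
  then obtain g :: "nat \<Rightarrow> int \<times> int" where g: "bij_betw g UNIV C"
    using bij_betw_from_nat_into[of C] by auto
  have inj: "inj d" "inj g" using g by (auto simp: d_def inj_def bij_betw_def)
  have ran: "range d \<inter> range g = {}" "range d \<union> range g = UNIV"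
    using g by (auto simp: bij_betw_def C_def)
  define e where "e = (\<lambda>n. if even n then d (n div 2) else g (n div 2))"
  have "inj e"
  proof (rule injI)
    fix m n assume "e m = e n"
    then have "even m = even n \<and> m div 2 = n div 2"
      using ran(1) inj by (auto simp: e_def inj_def split: if_splits)
    then show "m = n" by (metis dvd_imp_mod_0 mult_div_mod_eq odd_iff_mod_2_eq_one)
  qed
  moreover have "surj e"
  proof (unfold surj_def, rule allI)
    fix w
    from ran(2) consider k where "w = d k" | k where "w = g k" by blast
    then show "\<exists>n. w = e n"
    proof cases
      case 1
      then have "w = e (2 * k)" by (simp add: e_def)
      then show ?thesis by blast
    next
      case 2
      then have "w = e (Suc (2 * k))" by (simp add: e_def)
      then show ?thesis by blast
    qed
  qed
  moreover have "e (2 * k) = (- int k, - int k)" for k by (simp add: e_def d_def)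
  moreover have "pointed Q (e i) = pointed Q' (e i)" if "odd i" for i Q Q'
  proof (cases "e i")
    case (Pair x y)
    \<comment> \<open>Off the ray, \<open>pointed\<close> never consults its parameter.\<close>
    have "e i \<notin> range d" using that ran(1) by (auto simp: e_def)
    moreover have "e i = d (nat (- x))" if "x = y" "x \<le> 0" using that by (simp add: Pair d_def)
    ultimately have "\<not> (x = y \<and> x \<le> 0)" by blast
    then show ?thesis unfolding Pair pointed.simps by (simp only: if_False)
  qed
  ultimately show ?thesis by (blast intro: bijI)
qed

theorem proposition5p6:
  shows "pos_loc_unipotent_base_change_sets (cluster_algebra initial_seed)
           canonical_basis semicanonical_basis"
proof -
  obtain e where "bij e" and even: "\<And>k. e (2 * k) = (- int k, - int k)"
    and odd: "\<And>i Q Q'. odd i \<Longrightarrow> pointed Q (e i) = pointed Q' (e i)"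
    using exponent_enumeration by blast
  then have inj_e: "inj e" and surj_e: "range e = UNIV" by (auto simp: bij_def)
  define P where "P = (\<lambda>k. chebyshev_P k z)"
  define R where "R = (\<lambda>k. z ^ k)"
  define a where "a = pointed P \<circ> e"
  define b where "b = pointed R \<circ> e"
  \<comment> \<open>The transition matrix is the identity at odd positions and expands
    \<open>z ^ k\<close> in the \<open>P_i(z)\<close> at even ones.\<close>
  define m where "m = (\<lambda>i k. if even k then if even i then cheb_coeff (k div 2) (i div 2) else 0
    else of_bool (i = k))"
  have P: "lead (P k) (- int k) (- int k)" for k
    unfolding P_def by (rule lead_chebyshev_P[OF lead_z])
  have R: "lead (R k) (- int k) (- int k)" for k
    unfolding R_def using lead_power[OF lead_z, of k] by simp
  have range_a: "range a = range (pointed P)" and range_b: "range b = range (pointed R)"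
    unfolding a_def b_def by (simp_all add: surj_e flip: image_image[of _ e] image_comp)
  have canonical: "range a = canonical_basis" and semicanonical: "range b = semicanonical_basis"
    unfolding range_a range_b canonical_basis_def semicanonical_basis_def
    by (simp_all add: range_pointed P_def R_def chebyshev_P_0)
  have "b k = (\<Sum>i\<le>k. zscale (m i k) (a i))" for k
  proof (cases "even k")
    case True
    then obtain j where k: "k = 2 * j" by blast
    have "b k = R j" by (simp add: b_def k even pointed.simps)
    also have "\<dots> = (\<Sum>i\<le>j. zscale (m (2 * i) k) (a (2 * i)))"
      by (simp add: R_def power_eq_chebyshev_P[of z j] m_def k a_def even pointed.simps P_def zscale_def)
    also have "\<dots> = (\<Sum>i\<in>(*) 2 ` {..j}. zscale (m i k) (a i))"
      by (simp add: sum.reindex inj_on_def)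
    also have "\<dots> = (\<Sum>i\<le>k. zscale (m i k) (a i))"
    proof (rule sum.mono_neutral_left)
      show "\<forall>i\<in>{..k} - (*) 2 ` {..j}. zscale (m i k) (a i) = 0"
        by (auto simp: k m_def zscale_def elim!: evenE)
    qed (auto simp: k)
    finally show ?thesis .
  next
    case False
    then have "(\<Sum>i\<le>k. zscale (m i k) (a i)) = (\<Sum>i\<in>{k}. zscale (m i k) (a i))"
      by (intro sum.mono_neutral_right) (auto simp: m_def zscale_def)
    also have "\<dots> = b k"
      using False odd[of k P R] by (simp add: m_def zscale_def a_def b_def)
    finally show ?thesis by simp
  qed
  then have base_change: "zmod.span (a ` {..n}) = zmod.span (b ` {..n})"
    "\<exists>M. base_change_matrix a b n M \<and> unipotent_mat M \<and> nonneg_mat M" for n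
    by (rule unitriangular_base_change[of b m a];
        auto simp: m_def cheb_coeff_diag cheb_coeff_nonneg intro!: cheb_coeff_eq_0 elim!: evenE)+
  \<comment> \<open>Equality of all truncated spans passes to the full spans, so the spanning
    property of the semicanonical basis transfers to the canonical one.\<close>
  have "range f \<subseteq> zmod.span (range g)"
    if "\<And>n. zmod.span (f ` {..n}) = zmod.span (g ` {..n})" for f g :: "nat \<Rightarrow> ambient"
  proof (rule image_subsetI)
    fix k
    have "f k \<in> zmod.span (g ` {..k})"
      unfolding that[symmetric] by (rule zmod.span_base) simp
    then show "f k \<in> zmod.span (range g)"
      using zmod.span_mono[of "g ` {..k}" "range g"] by auto
  qed
  from this[of a b] this[of b a] have "range a \<subseteq> zmod.span (range b)" "range b \<subseteq> zmod.span (range a)"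
    using base_change(1) by auto
  then have spans: "zmod.span (range a) = zmod.span (range b)"
    by (simp add: zmod.span_eq)
  have "inj a" "inj b"
    unfolding a_def b_def using lead_inj[OF lead_pointed[OF P]] lead_inj[OF lead_pointed[OF R]] inj_e
    by (auto intro: inj_compose)
  moreover have "\<not> zmod.dependent (range a)" "\<not> zmod.dependent (range b)"
    unfolding range_a range_b
    using lead_independent[OF lead_pointed[OF P]] lead_independent[OF lead_pointed[OF R]] by blast+
  moreover have "zmod.span (range b) = cluster_algebra initial_seed"
    unfolding semicanonical by (rule span_semicanonical_basis)
  ultimately have "pos_loc_unipotent_base_change (cluster_algebra initial_seed) a b"
    unfolding pos_loc_unipotent_base_change_def enumerated_basis_def using base_change spans by auto
  then show ?thesis
    unfolding pos_loc_unipotent_base_change_sets_def using canonical semicanonical by blast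
qed

end
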